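(* Let $\lambda^1,\dots,\lambda^r\in P_n$ and let $I_m=\langle\lambda^1,\dots,\lambda^r\rangle_{\mathfrak S_m}\subseteq\Bbbk[x_1,\dots,x_m]$ for $m\in\{n,n+1\}$. Let $\mu=(\mu_1,\dots,\mu_n,\mu_{n+1})\in P_{n+1}$, $s=s(\mu)$, and $\mathbf c\in\mathbb Z_{\ge0}^s$ with $\mathbf c\le\mathbf p(\mu)$. For every $0\le i\le n$: (i) if $\mu_{n+1}=0$, then $\gamma_i^{\mu,\mathbf c}(I_{n+1})=\gamma_i^{(\mu_1,\dots,\mu_n),\mathbf c}(I_n)$; (ii) if $\mu_{n+1}>0$, then $$\gamma_i^{\mu,\mathbf c}(I_{n+1})=\begin{cases}0&\text{if }c_s=0;\\ \gamma_i^{(\mu_1,\dots,\mu_n),\mathbf c-\mathbf e_s}(I_n)&\text{if }c_s>0.\end{cases}$$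
   Context: $\Bbbk$ is a field. $P_m=\{(\lambda_1,\dots,\lambda_m)\in\mathbb Z^m\mid\lambda_1\ge\cdots\ge\lambda_m\ge0\}$; $(\lambda_1,\dots,\lambda_n)\in P_n$ is identified with $(\lambda_1,\dots,\lambda_n,0)\in P_{n+1}$. $\langle\lambda^1,\dots,\lambda^r\rangle_{\mathfrak S_m}\subseteq\Bbbk[x_1,\dots,x_m]$ is the ideal generated by all $\sigma(x^{\lambda^k})$, $\sigma\in\mathfrak S_m$ (permuting variables), $1\le k\le r$. For an $\mathfrak S_m$-invariant monomial ideal $I\subseteq\Bbbk[x_1,\dots,x_m]$, $P(I)=\{\lambda\in P_m\mid x^\lambda\in I\}$. For $\mu=(d_1^{p_1},\dots,d_s^{p_s},0^{p_{s+1}})\in P_m$ with $d_1>\cdots>d_s>0$, $p_1,\dots,p_s>0$, $p_{s+1}\ge0$ (exponents denote repetition), put $s(\mu)=s$ and $\mathbf p(\mu)=(p_1-1,\dots,p_s-1)$. For $\mathbf c\in\mathbb Z^s_{\ge0}$ with $\mathbf c\le(p_1,\dots,p_s)$, put $\mu\setminus\mathbf c=(d_1^{p_1-c_1},(d_1-1)^{c_1},\dots,d_s^{p_s-c_s},(d_s-1)^{c_s},0^{p_{s+1}})\in P_m$. With $\mathbf e_1,\dots,\mathbf e_s$ the standard vectors of $\mathbb Z^s$ and $\mathbf e_F=\sum_{i\in F}\mathbf e_i$ for $F\subseteq[s]=\{1,\dots,s\}$, define for $\mathbf c\le\mathbf p(\mu)$ the simplicial complex $\Delta^{\mu,\mathbf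 c}(I)=\{F\subseteq[s]\mid\mu\setminus(\mathbf c+\mathbf e_F)\in P(I)\}$ and $\gamma_i^{\mu,\mathbf c}(I)=\dim_\Bbbk\widetilde H_{i-1}(\Delta^{\mu,\mathbf c}(I))$ (reduced homology over $\Bbbk$; all reduced homology of the empty complex $\varnothing$ is $0$, while $\widetilde H_{-1}(\{\varnothing\})\cong\Bbbk$). All inequalities between vectors are componentwise. *)

theory Defs
  imports
    "HOL-Algebra.Ideal"
    "HOL-Combinatorics.Permutations"
    "HOL-Library.Poly_Mapping"
    "Jordan_Normal_Form.VS_Connect"
begin

text \<open>
  Polynomials over \<open>'k\<close> are finitely supported maps from exponent vectors
  (finitely supported maps from variable indices to exponents) to coefficients, with the
  convolution product of \<^theory>\<open>HOL-Library.Poly_Mapping\<close>. The indices of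
  \<open>x\<^sub>1, \<dots>, x\<^sub>m\<close> are \<open>1, \<dots>, m\<close>,
  whereas the entry \<open>\<lambda>\<^sub>i\<close> of a tuple is the list element \<open>l ! (i - 1)\<close>.
\<close>

type_synonym 'k mpol = "(nat \<Rightarrow>\<^sub>0 nat) \<Rightarrow>\<^sub>0 'k"

definition Var :: "nat \<Rightarrow> 'k::field mpol" where
  "Var i = Poly_Mapping.single (Poly_Mapping.single i 1) 1"

definition poly_ring :: "nat \<Rightarrow> 'k::field mpol ring" where
  "poly_ring m = \<lparr>carrier = {f. \<forall>t\<in>Poly_Mapping.keys f. Poly_Mapping.keys t \<subseteq> {1..m}},
     monoid.mult = (*), one = 1, zero = 0, add = (+)\<rparr>"

definition Parts :: "nat \<Rightarrow> nat list set" where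
  "Parts m = {l. length l = m \<and> sorted_wrt (\<ge>) l}"

text \<open>\<open>perm_mon \<sigma> l\<close> is the image of \<open>x\<^sup>l\<close> under
  \<open>x\<^sub>i \<mapsto> x\<^sub>\<sigma>\<^sub>(\<^sub>i\<^sub>)\<close>.\<close>

definition perm_mon :: "(nat \<Rightarrow> nat) \<Rightarrow> nat list \<Rightarrow> 'k::field mpol" where
  "perm_mon \<sigma> l = (\<Prod>i=1..length l. Var (\<sigma> i) ^ (l ! (i - 1)))"

definition mon :: "nat list \<Rightarrow> 'k::field mpol" where
  "mon l = perm_mon id l"

definition sym_ideal :: "nat \<Rightarrow> nat list set \<Rightarrow> 'k::field mpol set" where
  "sym_ideal m L = Idl\<^bsub>poly_ring m\<^esub> {perm_mon \<sigma> l | \<sigma> l. \<sigma> permutes {1..m} \<and> l \<in> L}"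

definition Parts_of_ideal :: "nat \<Rightarrow> 'k::field mpol set \<Rightarrow> nat list set" where
  "Parts_of_ideal m I = {l \<in> Parts m. mon l \<in> I}"

text \<open>
  For \<open>\<mu> = (d\<^sub>1\<^sup>p\<^sup>1, \<dots>, d\<^sub>s\<^sup>p\<^sup>s, 0\<^sup>p\<^sup>')\<close> with
  \<open>d\<^sub>1 > \<dots> > d\<^sub>s > 0\<close>, the list \<open>vals \<mu>\<close> is \<open>[d\<^sub>1, \<dots>, d\<^sub>s]\<close>,
  and \<open>blocks \<mu> = s\<close>, \<open>val \<mu> i = d\<^sub>i\<close>, \<open>mult_val \<mu> i = p\<^sub>i\<close>
  for \<open>1 \<le> i \<le> s\<close>. Below, \<open>strip \<mu> c\<close> is \<open>\<mu> \ c\<close>.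
\<close>

definition vals :: "nat list \<Rightarrow> nat list" where
  "vals \<mu> = rev (sorted_list_of_set (set \<mu> - {0}))"

definition blocks :: "nat list \<Rightarrow> nat" where
  "blocks \<mu> = length (vals \<mu>)"

definition val :: "nat list \<Rightarrow> nat \<Rightarrow> nat" where
  "val \<mu> i = vals \<mu> ! (i - 1)"

definition mult_val :: "nat list \<Rightarrow> nat \<Rightarrow> nat" where
  "mult_val \<mu> i = count_list \<mu> (val \<mu> i)"

text \<open>
  A vector in \<open>\<int>\<^sup>s\<close> with nonnegative entries is a function on \<open>nat\<close> of which
  only the values at \<open>1, \<dots>, s\<close> are ever used.
  \<open>below_p \<mu> c\<close> is \<open>\<^bold>c \<le> \<^bold>p(\<mu>)\<close>; the
  truncated subtraction is harmless because \<open>p\<^sub>i > 0\<close>.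
\<close>

definition below_p :: "nat list \<Rightarrow> (nat \<Rightarrow> nat) \<Rightarrow> bool" where
  "below_p \<mu> c \<longleftrightarrow> (\<forall>i\<in>{1..blocks \<mu>}. c i \<le> mult_val \<mu> i - 1)"

definition eF :: "nat set \<Rightarrow> nat \<Rightarrow> nat" where
  "eF F = (\<lambda>i. if i \<in> F then 1 else 0)"

definition strip :: "nat list \<Rightarrow> (nat \<Rightarrow> nat) \<Rightarrow> nat list" where
  "strip \<mu> c =
     concat (map (\<lambda>i. replicate (mult_val \<mu> i - c i) (val \<mu> i) @ replicate (c i) (val \<mu> i - 1))
                 [1..<Suc (blocks \<mu>)])
     @ replicate (count_list \<mu> 0) 0"

text \<open>
  A simplicial complex is the set of its faces, finite sets of naturals; the void complex
  \<open>{}\<close> and the irrelevant complex \<open>{{}}\<close> are distinct. In the augmented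
  oriented chain complex the face \<open>{}\<close> sits in degree \<open>-1\<close>, and faces are oriented by
  the order of their vertices: for \<open>v\<^sub>0 < \<dots> < v\<^sub>j\<close> the face opposite
  \<open>v\<^sub>k\<close> gets the sign \<open>(-1)\<^sup>k\<close>.
\<close>

type_synonym 'k chain = "nat set \<Rightarrow>\<^sub>0 'k"

definition simp_chains :: "nat set set \<Rightarrow> int \<Rightarrow> 'k::field chain set" where
  "simp_chains \<Delta> j = {c. Poly_Mapping.keys c \<subseteq> {F \<in> \<Delta>. int (card F) = j + 1}}"

definition bdry :: "'k::field chain \<Rightarrow> 'k chain" where
  "bdry c = (\<Sum>F\<in>Poly_Mapping.keys c. \<Sum>v\<in>F.
     Poly_Mapping.single (F - {v}) ((-1) ^ card {u \<in> F. u < v} * Poly_Mapping.lookup c F))"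

definition simp_cycles :: "nat set set \<Rightarrow> int \<Rightarrow> 'k::field chain set" where
  "simp_cycles \<Delta> j = {c \<in> simp_chains \<Delta> j. bdry c = 0}"

definition simp_boundaries :: "nat set set \<Rightarrow> int \<Rightarrow> 'k::field chain set" where
  "simp_boundaries \<Delta> j = bdry ` simp_chains \<Delta> (j + 1)"

text \<open>The quotient space of cycles modulo boundaries; its elements are cosets. The fields
  \<open>mult\<close> and \<open>one\<close> of the record play no role for modules.\<close>

definition red_homology :: "nat set set \<Rightarrow> int \<Rightarrow> ('k::field, 'k chain set) module" where
  "red_homology \<Delta> j = \<lparr>
     carrier = {{z + b | b. b \<in> simp_boundaries \<Delta> j} | z. z \<in> simp_cycles \<Delta> j},
     monoid.mult = undefined, one = undefined,
     zero = simp_boundaries \<Delta> j,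
     add = (\<lambda>X Y. {x + y | x y. x \<in> X \<and> y \<in> Y}),
     module.smult = (\<lambda>a X. {Poly_Mapping.map ((*) a) x + b | x b. x \<in> X \<and> b \<in> simp_boundaries \<Delta> j})\<rparr>"

definition dim_red_homology :: "'k::field itself \<Rightarrow> nat set set \<Rightarrow> int \<Rightarrow> nat" where
  "dim_red_homology _ \<Delta> j =
     vectorspace.dim (class_ring :: 'k ring) (red_homology \<Delta> j :: ('k, 'k chain set) module)"

text \<open>The number of variables is not an extra parameter: it is the length of \<open>\<mu>\<close>.\<close>

definition Delta :: "nat list \<Rightarrow> (nat \<Rightarrow> nat) \<Rightarrow> 'k::field mpol set \<Rightarrow> nat set set" where
  "Delta \<mu> c I = {F. F \<subseteq> {1..blocks \<mu>} \<and>
     strip \<mu> (\<lambda>i. c i + eF F i) \<in> Parts_of_ideal (length \<mu>) I}"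

definition gam :: "nat list \<Rightarrow> (nat \<Rightarrow> nat) \<Rightarrow> nat \<Rightarrow> 'k::field mpol set \<Rightarrow> nat" where
  "gam \<mu> c i I = dim_red_homology TYPE('k) (Delta \<mu> c I) (int i - 1)"

end

theory Submission
  imports Defs
begin

text \<open>
  Appending \<open>0\<close> to the generators makes the last variable free: a partition \<open>\<nu> @ [x]\<close>
  lies in \<open>P(I\<^sub>n\<^sub>+\<^sub>1)\<close> exactly when \<open>\<nu>\<close> lies in \<open>P(I\<^sub>n)\<close>, since both
  say that \<open>\<nu>\<close> dominates some \<open>\<lambda>\<^sup>k\<close> entrywise (\<open>append_in_Parts_of_ideal_iff\<close>). So
  membership of \<open>\<mu> \ (\<^bold>c + \<^bold>e\<^sub>F)\<close> in \<open>P(I\<^sub>n\<^sub>+\<^sub>1)\<close> depends only on what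
  remains after its last entry is deleted.

  If \<open>\<mu>\<^sub>n\<^sub>+\<^sub>1 = 0\<close>, the deleted entry is a zero, stripping does not touch it, and the two
  complexes coincide (\<open>Delta_append_zero\<close>). If \<open>\<mu>\<^sub>n\<^sub>+\<^sub>1 > 0\<close>, the last entry belongs to the
  block of \<open>d\<^sub>s\<close>. When \<open>c\<^sub>s > 0\<close> it has always been lowered to \<open>d\<^sub>s - 1\<close>, so deleting
  it uses up one of the \<open>c\<^sub>s\<close> lowered entries and the complexes again coincide, with
  \<open>\<^bold>c - \<^bold>e\<^sub>s\<close> in place of \<open>\<^bold>c\<close> (\<open>Delta_drop_last\<close>). When \<open>c\<^sub>s = 0\<close>,
  adding \<open>s\<close> to a face lowers the last entry and no other, which membership does not see; the
  complex is therefore void or a cone with apex \<open>s\<close> (\<open>Delta_insert_last\<close>), and its reduced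
  homology vanishes by the usual contracting homotopy (\<open>dim_red_homology_cone\<close>).
\<close>

section \<open>Monomials in a symmetric monomial ideal\<close>

definition exponent :: "(nat \<Rightarrow> nat) \<Rightarrow> nat list \<Rightarrow> nat \<Rightarrow>\<^sub>0 nat" where
  "exponent \<sigma> l = (\<Sum>i=1..length l. Poly_Mapping.single (\<sigma> i) (l ! (i - 1)))"

lemma Var_power: "(Var i :: 'k::field mpol) ^ k = Poly_Mapping.single (Poly_Mapping.single i k) 1"
  by (induction k) (simp_all add: Var_def mult_single flip: single_add)

lemma perm_mon_eq_single: "(perm_mon \<sigma> l :: 'k::field mpol) = Poly_Mapping.single (exponent \<sigma> l) 1"
proof -
  have "(\<Prod>i\<in>A. (Var (\<sigma> i) :: 'k mpol) ^ (l ! (i - 1)))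
      = Poly_Mapping.single (\<Sum>i\<in>A. Poly_Mapping.single (\<sigma> i) (l ! (i - 1))) 1" if "finite A" for A
    using that by induction (simp_all add: Var_power mult_single)
  then show ?thesis
    by (simp add: perm_mon_def exponent_def)
qed

lemma lookup_exponent:
  assumes "inj \<sigma>" "1 \<le> j" "j \<le> length l"
  shows "Poly_Mapping.lookup (exponent \<sigma> l) (\<sigma> j) = l ! (j - 1)"
proof -
  have "Poly_Mapping.lookup (exponent \<sigma> l) (\<sigma> j)
      = (\<Sum>i=1..length l. if i = j then l ! (i - 1) else 0)"
    using assms(1) unfolding exponent_def lookup_sum
    by (intro sum.cong) (auto simp: lookup_single when_def dest: injD)
  then show ?thesis
    using assms by simp
qed

lemma keys_sum_subset: "Poly_Mapping.keys (\<Sum>a\<in>A. f a) \<subseteq> (\<Union>a\<in>A. Poly_Mapping.keys (f a))"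
proof (cases "finite A")
  case True
  then show ?thesis
    by induction (use keys_add in fastforce)+
qed simp

lemma keys_exponent: "Poly_Mapping.keys (exponent \<sigma> l) \<subseteq> \<sigma> ` {1..length l}"
  unfolding exponent_def by (rule order_trans[OF keys_sum_subset]) auto

lemma ring_poly_ring: "ring (poly_ring m :: 'k::field mpol ring)"
proof (rule ringI)
  show "abelian_group (poly_ring m :: 'k mpol ring)"
  proof (rule abelian_groupI)
    fix x :: "'k mpol" assume x: "x \<in> carrier (poly_ring m)"
    show "\<exists>y\<in>carrier (poly_ring m). y \<oplus>\<^bsub>poly_ring m\<^esub> x = \<zero>\<^bsub>poly_ring m\<^esub>"
      by (rule bexI[of _ "- x"]) (use x in \<open>auto simp: poly_ring_def\<close>)
  qed (use keys_add in \<open>fastforce simp: poly_ring_def add_ac\<close>)+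
  show "monoid (poly_ring m :: 'k mpol ring)"
  proof (rule monoidI)
    fix x y :: "'k mpol"
    assume xy: "x \<in> carrier (poly_ring m)" "y \<in> carrier (poly_ring m)"
    have "Poly_Mapping.keys t \<subseteq> {1..m}" if t: "t \<in> Poly_Mapping.keys (x * y)" for t
    proof -
      obtain a b where "t = a + b" "a \<in> Poly_Mapping.keys x" "b \<in> Poly_Mapping.keys y"
        using t keys_mult by blast
      then show ?thesis
        using xy keys_add[of a b] by (fastforce simp: poly_ring_def)
    qed
    then show "x \<otimes>\<^bsub>poly_ring m\<^esub> y \<in> carrier (poly_ring m)"
      by (simp add: poly_ring_def)
  qed (auto simp: poly_ring_def mult.assoc)
qed (auto simp: poly_ring_def algebra_simps)

text \<open>
  The polynomials whose monomials are all divisible by some generator form an ideal that contains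
  the generators, hence all of \<open>sym_ideal m L\<close>. Divisibility is expressed by comparing
  exponent vectors.
\<close>
lemma mon_sym_ideal_imp_divides:
  assumes L: "\<And>l. l \<in> L \<Longrightarrow> length l = m" and I: "(mon \<nu> :: 'k::field mpol) \<in> sym_ideal m L"
  shows "\<exists>\<sigma> l. \<sigma> permutes {1..m} \<and> l \<in> L \<and>
           (\<forall>x. Poly_Mapping.lookup (exponent \<sigma> l) x \<le> Poly_Mapping.lookup (exponent id \<nu>) x)"
proof -
  let ?R = "poly_ring m :: 'k mpol ring"
  define D where "D t \<longleftrightarrow> (\<exists>\<sigma> l. \<sigma> permutes {1..m} \<and> l \<in> L \<and>
      (\<forall>x. Poly_Mapping.lookup (exponent \<sigma> l) x \<le> Poly_Mapping.lookup t x))"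
    for t :: "nat \<Rightarrow>\<^sub>0 nat"
  define J where "J = {f \<in> carrier ?R. \<forall>t\<in>Poly_Mapping.keys f. D t}"
  have D_add: "D (a + b) \<and> D (b + a)" if "D a" for a b
    using that unfolding D_def lookup_add by (meson trans_le_add1 trans_le_add2)
  interpret ring ?R
    by (rule ring_poly_ring)
  have "ideal J ?R"
  proof (rule idealI)
    show "subgroup J (add_monoid ?R)"
    proof (rule add.subgroupI)
      show "J \<subseteq> carrier ?R" by (auto simp: J_def)
      have "0 \<in> J" by (simp add: J_def poly_ring_def)
      then show "J \<noteq> {}" by blast
    next
      fix a assume a: "a \<in> J"
      then have "a \<in> carrier ?R" "- a \<in> carrier ?R" by (auto simp: J_def poly_ring_def)
      then have "\<ominus>\<^bsub>?R\<^esub> a = - a"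
        by (intro minus_equality) (auto simp: poly_ring_def)
      then show "\<ominus>\<^bsub>?R\<^esub> a \<in> J"
        using a by (auto simp: J_def poly_ring_def)
    next
      fix a b assume ab: "a \<in> J" "b \<in> J"
      then have "a \<oplus>\<^bsub>?R\<^esub> b \<in> carrier ?R" by (auto simp: J_def)
      moreover have "\<forall>t\<in>Poly_Mapping.keys (a + b). D t"
        using ab keys_add[of a b] by (auto simp: J_def)
      ultimately show "a \<oplus>\<^bsub>?R\<^esub> b \<in> J"
        by (simp add: J_def poly_ring_def)
    qed
  next
    fix a x assume ax: "a \<in> J" "x \<in> carrier ?R"
    then have "x \<otimes>\<^bsub>?R\<^esub> a \<in> carrier ?R" "a \<otimes>\<^bsub>?R\<^esub> x \<in> carrier ?R" by (auto simp: J_def)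
    moreover have "\<forall>t\<in>Poly_Mapping.keys (x * a) \<union> Poly_Mapping.keys (a * x). D t"
      using ax D_add keys_mult[of x a] keys_mult[of a x] by (fastforce simp: J_def)
    ultimately show "x \<otimes>\<^bsub>?R\<^esub> a \<in> J" "a \<otimes>\<^bsub>?R\<^esub> x \<in> J"
      by (auto simp: J_def poly_ring_def)
  qed (rule ring_poly_ring)
  moreover have "{perm_mon \<sigma> l | \<sigma> l. \<sigma> permutes {1..m} \<and> l \<in> L} \<subseteq> J"
  proof clarify
    fix \<sigma> l assume \<sigma>: "\<sigma> permutes {1..m}" and l: "l \<in> L"
    have "Poly_Mapping.keys (exponent \<sigma> l) \<subseteq> {1..m}"
      using keys_exponent[of \<sigma> l] permutes_image[OF \<sigma>] L[OF l] by simp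
    then show "perm_mon \<sigma> l \<in> J"
      using \<sigma> l by (auto simp: J_def poly_ring_def perm_mon_eq_single D_def)
  qed
  ultimately have "sym_ideal m L \<subseteq> J"
    unfolding sym_ideal_def by (rule genideal_minimal)
  then show ?thesis
    using I by (auto simp: J_def mon_def perm_mon_eq_single D_def)
qed

text \<open>
  Divisibility by a permuted generator implies divisibility by the sorted one. Among
  \<open>\<sigma> 1, \<dots>, \<sigma> (i + 1)\<close> one value exceeds \<open>i\<close>, say at \<open>j\<close>; as both
  sequences decrease, the \<open>i\<close>-th entry (from zero) of \<open>a\<close> is at most \<open>a ! (j - 1)\<close>
  and that of \<open>\<nu>\<close> is at least \<open>\<nu> ! (\<sigma> j - 1)\<close>.
\<close>
lemma permuted_le_imp_le:
  assumes a: "a \<in> Parts m" and \<nu>: "\<nu> \<in> Parts m" and \<sigma>: "\<sigma> permutes {1..m}"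
    and le: "\<And>j. 1 \<le> j \<Longrightarrow> j \<le> m \<Longrightarrow> a ! (j - 1) \<le> \<nu> ! (\<sigma> j - 1)" and i: "i < m"
  shows "a ! i \<le> \<nu> ! i"
proof -
  have mono: "l ! y \<le> l ! x" if "l \<in> Parts m" "x \<le> y" "y < m" for l x y
    using that unfolding Parts_def
    by (cases "x = y") (auto simp: sorted_wrt_iff_nth_less)
  have "\<not> \<sigma> ` {1..Suc i} \<subseteq> {1..i}"
  proof
    assume "\<sigma> ` {1..Suc i} \<subseteq> {1..i}"
    then have "card (\<sigma> ` {1..Suc i}) \<le> i"
      using card_mono[of "{1..i}"] by fastforce
    moreover have "card (\<sigma> ` {1..Suc i}) = Suc i"
      using card_image[OF inj_on_subset[OF permutes_inj[OF \<sigma>] subset_UNIV]] by simp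
    ultimately show False by simp
  qed
  then obtain x where "x \<in> \<sigma> ` {1..Suc i}" "x \<notin> {1..i}" by blast
  then obtain j where j: "1 \<le> j" "j \<le> Suc i" "\<sigma> j \<notin> {1..i}" by fastforce
  have \<sigma>j: "\<sigma> j \<in> {1..m}"
    using j i permutes_in_image[OF \<sigma>, of j] by auto
  have "a ! i \<le> a ! (j - 1)" using mono[OF a] j i by simp
  also have "\<dots> \<le> \<nu> ! (\<sigma> j - 1)" using le j i by simp
  also have "\<dots> \<le> \<nu> ! i" using mono[OF \<nu>] j \<sigma>j by auto
  finally show ?thesis .
qed

lemma mon_in_sym_ideal_iff:
  assumes L: "L \<subseteq> Parts m" and \<nu>: "\<nu> \<in> Parts m"
  shows "(mon \<nu> :: 'k::field mpol) \<in> sym_ideal m L \<longleftrightarrow> (\<exists>a\<in>L. \<forall>i<m. a ! i \<le> \<nu> ! i)"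
proof
  assume "(mon \<nu> :: 'k mpol) \<in> sym_ideal m L"
  then obtain \<sigma> a where \<sigma>: "\<sigma> permutes {1..m}" and a: "a \<in> L"
    and le: "\<And>x. Poly_Mapping.lookup (exponent \<sigma> a) x \<le> Poly_Mapping.lookup (exponent id \<nu>) x"
    using mon_sym_ideal_imp_divides[of L m \<nu>] L by (auto simp: Parts_def)
  have len: "length a = m" "length \<nu> = m"
    using a L \<nu> by (auto simp: Parts_def)
  have "a ! (j - 1) \<le> \<nu> ! (\<sigma> j - 1)" if "1 \<le> j" "j \<le> m" for j
  proof -
    have "\<sigma> j \<in> {1..m}" using that permutes_in_image[OF \<sigma>] by auto
    then show ?thesis
      using le[of "\<sigma> j"] lookup_exponent[of \<sigma> j a] lookup_exponent[of id "\<sigma> j" \<nu>]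
        permutes_inj[OF \<sigma>] that len by simp
  qed
  then show "\<exists>a\<in>L. \<forall>i<m. a ! i \<le> \<nu> ! i"
    using permuted_le_imp_le[OF _ \<nu> \<sigma>] a L by blast
next
  assume "\<exists>a\<in>L. \<forall>i<m. a ! i \<le> \<nu> ! i"
  then obtain a where a: "a \<in> L" and le: "\<And>i. i < m \<Longrightarrow> a ! i \<le> \<nu> ! i" by blast
  have len: "length a = m" "length \<nu> = m"
    using a L \<nu> by (auto simp: Parts_def)
  define t where "t = exponent id \<nu> - exponent id a"
  have le': "Poly_Mapping.lookup (exponent id a) x \<le> Poly_Mapping.lookup (exponent id \<nu>) x" for x
  proof (cases "1 \<le> x \<and> x \<le> m")
    case True
    then have "x - 1 < m" by linarith
    with True show ?thesis
      using le[of "x - 1"] len lookup_exponent[of id x a] lookup_exponent[of id x \<nu>] by simp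
  next
    case False
    then have "x \<notin> Poly_Mapping.keys (exponent id a)"
      using keys_exponent[of id a] len by auto
    then show ?thesis by (simp add: in_keys_iff)
  qed
  have "exponent id \<nu> = t + exponent id a"
    by (rule poly_mapping_eqI) (simp add: t_def lookup_add lookup_minus le')
  then have eq: "(mon \<nu> :: 'k mpol) = Poly_Mapping.single t 1 * perm_mon id a"
    by (simp add: mon_def perm_mon_eq_single mult_single)
  have t: "Poly_Mapping.keys t \<subseteq> {1..m}"
  proof
    fix x assume "x \<in> Poly_Mapping.keys t"
    then have "x \<in> Poly_Mapping.keys (exponent id \<nu>)"
      by (auto simp: t_def in_keys_iff lookup_minus)
    then show "x \<in> {1..m}" using keys_exponent[of id \<nu>] len by auto
  qed
  show "(mon \<nu> :: 'k mpol) \<in> sym_ideal m L"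
    unfolding sym_ideal_def genideal_def
  proof clarify
    fix I assume I: "ideal I (poly_ring m :: 'k mpol ring)"
      and gens: "{perm_mon \<sigma> l | \<sigma> l. \<sigma> permutes {1..m} \<and> l \<in> L} \<subseteq> I"
    have "perm_mon id a \<in> I" using gens a permutes_id by blast
    then show "mon \<nu> \<in> I"
      using ideal.I_l_closed[OF I, of "perm_mon id a" "Poly_Mapping.single t 1"] t eq
      by (simp add: poly_ring_def)
  qed
qed

lemma append_in_Parts_iff: "\<nu> @ [x] \<in> Parts (Suc n) \<longleftrightarrow> \<nu> \<in> Parts n \<and> (\<forall>y\<in>set \<nu>. x \<le> y)"
  by (auto simp: Parts_def sorted_wrt_append)

text \<open>
  The entry \<open>0\<close> appended to each generator imposes no condition on \<open>x\<close>; only the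
  requirement that \<open>\<nu> @ [x]\<close> be a partition remains.
\<close>
lemma append_in_Parts_of_ideal_iff:
  assumes L: "L \<subseteq> Parts n"
  shows "\<nu> @ [x] \<in> Parts_of_ideal (Suc n) (sym_ideal (Suc n) ((\<lambda>l. l @ [0]) ` L) :: 'k::field mpol set)
     \<longleftrightarrow> \<nu> \<in> Parts_of_ideal n (sym_ideal n L :: 'k mpol set) \<and> (\<forall>y\<in>set \<nu>. x \<le> y)"
proof (cases "\<nu> @ [x] \<in> Parts (Suc n)")
  case True
  then have \<nu>: "\<nu> \<in> Parts n" and x: "\<forall>y\<in>set \<nu>. x \<le> y"
    by (auto simp: append_in_Parts_iff)
  have L': "(\<lambda>l. l @ [0]) ` L \<subseteq> Parts (Suc n)"
    using L by (auto simp: append_in_Parts_iff)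
  have "(\<forall>i<Suc n. (a @ [0]) ! i \<le> (\<nu> @ [x]) ! i) \<longleftrightarrow> (\<forall>i<n. a ! i \<le> \<nu> ! i)" if "a \<in> L" for a
    using that L \<nu> by (auto simp: Parts_def nth_append less_Suc_eq subset_iff)
  then show ?thesis
    using mon_in_sym_ideal_iff[OF L' True, where 'k='k] mon_in_sym_ideal_iff[OF L \<nu>, where 'k='k]
      True \<nu> x by (auto simp: Parts_of_ideal_def)
qed (auto simp: append_in_Parts_iff Parts_of_ideal_def)

section \<open>Cones have no reduced homology\<close>

lemma bdry_zero [simp]: "bdry 0 = 0"
  by (simp add: bdry_def)

lemma bdry_add: "bdry (a + b) = bdry a + bdry b"
  unfolding bdry_def
  by (rule setsum_keys_plus_distrib) (simp_all add: single_add distrib_left sum.distrib)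

lemma bdry_single:
  "bdry (Poly_Mapping.single F x)
     = (\<Sum>v\<in>F. Poly_Mapping.single (F - {v}) ((-1) ^ card {u \<in> F. u < v} * x))"
  by (simp add: bdry_def)

lemma lookup_scale: "Poly_Mapping.lookup (Poly_Mapping.map ((*) a) x) F = (a :: 'k::field) * Poly_Mapping.lookup x F"
  by (simp add: Poly_Mapping.map.rep_eq when_def)

lemma bdry_scale: "bdry (Poly_Mapping.map ((*) a) x) = Poly_Mapping.map ((*) (a :: 'k::field)) (bdry x)"
proof (rule poly_mapping_eqI)
  fix G
  have "bdry (Poly_Mapping.map ((*) a) x) = (\<Sum>F\<in>Poly_Mapping.keys x. \<Sum>v\<in>F.
     Poly_Mapping.single (F - {v}) ((-1) ^ card {u \<in> F. u < v} * (a * Poly_Mapping.lookup x F)))"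
    unfolding bdry_def lookup_scale
    by (rule sum.mono_neutral_left) (auto simp: in_keys_iff lookup_scale)
  then show "Poly_Mapping.lookup (bdry (Poly_Mapping.map ((*) a) x)) G
      = Poly_Mapping.lookup (Poly_Mapping.map ((*) a) (bdry x)) G"
    by (simp add: lookup_scale bdry_def lookup_sum sum_distrib_left lookup_single mult_when mult_ac)
qed

text \<open>
  The cone on a chain with apex \<open>v\<close>, by \<open>F \<mapsto> F \<union> {v}\<close>. Faces are oriented by the order of
  their vertices, so the sign is that of moving \<open>v\<close> from the front to its place in
  \<open>F \<union> {v}\<close>. Faces that already contain \<open>v\<close> become degenerate and are sent to \<open>0\<close>.
\<close>
definition cone_op :: "nat \<Rightarrow> 'k::field chain \<Rightarrow> 'k chain" where
  "cone_op v c = (\<Sum>F\<in>Poly_Mapping.keys c. if v \<in> F then 0 else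
     Poly_Mapping.single (insert v F) ((-1) ^ card {u \<in> F. u < v} * Poly_Mapping.lookup c F))"

lemma cone_op_zero [simp]: "cone_op v 0 = 0"
  by (simp add: cone_op_def)

lemma cone_op_add: "cone_op v (a + b) = cone_op v a + cone_op v b"
  unfolding cone_op_def
  by (rule setsum_keys_plus_distrib) (simp_all add: single_add distrib_left)

lemma cone_op_single:
  "cone_op v (Poly_Mapping.single F x)
     = (if v \<in> F then 0 else Poly_Mapping.single (insert v F) ((-1) ^ card {u \<in> F. u < v} * x))"
  by (simp add: cone_op_def)

lemma cone_op_sum: "cone_op v (\<Sum>a\<in>A. f a) = (\<Sum>a\<in>A. cone_op v (f a))"
  using sum_comp_morphism[of "cone_op v" f A] by (simp add: cone_op_add comp_def)

text \<open>
  If \<open>v \<in> F\<close>, only the face opposite \<open>v\<close> survives coning, and its two equal signs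
  cancel. If \<open>v \<notin> F\<close>, the face of \<open>F \<union> {v}\<close> opposite \<open>v\<close> gives \<open>F\<close>, and each
  remaining face \<open>(F - {u}) \<union> {v}\<close> occurs once in either summand, with opposite signs: of
  the two positions of \<open>u\<close> and \<open>v\<close>, removing \<open>u\<close> shifts that of \<open>v\<close> when
  \<open>u < v\<close>, and inserting \<open>v\<close> shifts that of \<open>u\<close> otherwise.
\<close>
lemma cone_homotopy_single:
  assumes F: "finite F"
  shows "bdry (cone_op v (Poly_Mapping.single F (x :: 'k::field)))
           + cone_op v (bdry (Poly_Mapping.single F x)) = Poly_Mapping.single F x"
proof (cases "v \<in> F")
  case True
  have "cone_op v (bdry (Poly_Mapping.single F x))
      = (\<Sum>u\<in>F. if u = v then Poly_Mapping.single (insert v (F - {v}))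
           ((-1) ^ card {w \<in> F - {v}. w < v} * ((-1) ^ card {w \<in> F. w < v} * x)) else 0)"
    unfolding bdry_single cone_op_sum using True
    by (intro sum.cong) (auto simp: cone_op_single)
  also have "\<dots> = Poly_Mapping.single F ((-1) ^ card {w \<in> F - {v}. w < v} * ((-1) ^ card {w \<in> F. w < v} * x))"
    using True F by (simp add: insert_absorb)
  also have "{w \<in> F - {v}. w < v} = {w \<in> F. w < v}" by auto
  finally show ?thesis
    using True by (simp add: cone_op_single flip: power_add mult.assoc)
next
  case False
  define sg :: "nat \<Rightarrow> nat set \<Rightarrow> 'k" where "sg u A = (-1) ^ card {w \<in> A. w < u}" for u A
  have sq: "sg v F * sg v F = 1"
    by (simp add: sg_def flip: power_add)
  have "{w \<in> insert v F. w < v} = {w \<in> F. w < v}" by auto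
  then have sv: "sg v (insert v F) = sg v F" by (simp add: sg_def)
  have sign: "sg u (insert v F) * sg v F = - (sg v (F - {u}) * sg u F)" if u: "u \<in> F" for u
  proof (cases "u < v")
    case True
    then have "{w \<in> insert v F. w < u} = {w \<in> F. w < u}"
        "{w \<in> F. w < v} = insert u {w \<in> F - {u}. w < v}"
      using u by auto
    then show ?thesis using F by (simp add: sg_def)
  next
    case False
    with u \<open>v \<notin> F\<close> have "v < u" by (metis nat_neq_iff)
    then have "{w \<in> insert v F. w < u} = insert v {w \<in> F. w < u}"
        "{w \<in> F - {u}. w < v} = {w \<in> F. w < v}"
      by auto
    then show ?thesis using F \<open>v \<notin> F\<close> by (simp add: sg_def)
  qed
  have "bdry (cone_op v (Poly_Mapping.single F x))
      = (\<Sum>u\<in>insert v F. Poly_Mapping.single (insert v F - {u}) (sg u (insert v F) * (sg v F * x)))"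
    using False by (simp add: cone_op_single bdry_single sg_def)
  also have "\<dots> = Poly_Mapping.single F x
      + (\<Sum>u\<in>F. Poly_Mapping.single (insert v F - {u}) (sg u (insert v F) * (sg v F * x)))"
    using False F sq by (simp add: sv flip: mult.assoc)
  also have "(\<Sum>u\<in>F. Poly_Mapping.single (insert v F - {u}) (sg u (insert v F) * (sg v F * x)))
      = - (\<Sum>u\<in>F. Poly_Mapping.single (insert v (F - {u})) (sg v (F - {u}) * (sg u F * x)))"
    unfolding sum_negf[symmetric]
  proof (rule sum.cong)
    fix u assume u: "u \<in> F"
    then have "insert v F - {u} = insert v (F - {u})" using False by auto
    moreover have "sg u (insert v F) * (sg v F * x) = - (sg v (F - {u}) * (sg u F * x))"
      by (simp add: sign[OF u] flip: mult.assoc)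
    ultimately show "Poly_Mapping.single (insert v F - {u}) (sg u (insert v F) * (sg v F * x))
        = - Poly_Mapping.single (insert v (F - {u})) (sg v (F - {u}) * (sg u F * x))"
      by (simp add: single_uminus)
  qed simp
  also have "(\<Sum>u\<in>F. Poly_Mapping.single (insert v (F - {u})) (sg v (F - {u}) * (sg u F * x)))
      = cone_op v (bdry (Poly_Mapping.single F x))"
    unfolding bdry_single cone_op_sum using False by (simp add: cone_op_single sg_def)
  finally show ?thesis by simp
qed

lemma sum_single_keys: "(\<Sum>F\<in>Poly_Mapping.keys c. Poly_Mapping.single F (Poly_Mapping.lookup c F)) = c"
proof (rule poly_mapping_eqI)
  fix G
  have "(\<Sum>F\<in>Poly_Mapping.keys c. Poly_Mapping.lookup (Poly_Mapping.single F (Poly_Mapping.lookup c F)) G)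
      = (\<Sum>F\<in>Poly_Mapping.keys c. if F = G then Poly_Mapping.lookup c G else 0)"
    by (intro sum.cong) (auto simp: lookup_single)
  then show "Poly_Mapping.lookup (\<Sum>F\<in>Poly_Mapping.keys c. Poly_Mapping.single F (Poly_Mapping.lookup c F)) G
      = Poly_Mapping.lookup c G"
    by (simp add: lookup_sum in_keys_iff)
qed

lemma cone_homotopy:
  assumes fin: "\<And>F. F \<in> Poly_Mapping.keys c \<Longrightarrow> finite F"
  shows "bdry (cone_op v c) + cone_op v (bdry c) = (c :: 'k::field chain)"
proof -
  define \<phi> :: "'k chain \<Rightarrow> 'k chain" where "\<phi> z = bdry (cone_op v z) + cone_op v (bdry z)" for z
  have "\<phi> (\<Sum>F\<in>A. f F) = (\<Sum>F\<in>A. \<phi> (f F))" for A :: "nat set set" and f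
    using sum_comp_morphism[of \<phi> f A]
    by (simp add: \<phi>_def comp_def cone_op_add bdry_add add_ac)
  then have "\<phi> c = (\<Sum>F\<in>Poly_Mapping.keys c. \<phi> (Poly_Mapping.single F (Poly_Mapping.lookup c F)))"
    using sum_single_keys[of c] by metis
  also have "\<dots> = c"
    using fin by (simp add: \<phi>_def cone_homotopy_single sum_single_keys)
  finally show ?thesis by (simp add: \<phi>_def)
qed

lemma simp_chains_add: "a \<in> simp_chains \<Delta> j \<Longrightarrow> b \<in> simp_chains \<Delta> j \<Longrightarrow> a + b \<in> simp_chains \<Delta> j"
  using keys_add[of a b] by (fastforce simp: simp_chains_def)

lemma simp_chains_scale: "a \<in> simp_chains \<Delta> j \<Longrightarrow> Poly_Mapping.map ((*) k) a \<in> simp_chains \<Delta> j"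
  by (auto simp: simp_chains_def in_keys_iff lookup_scale)

lemma simp_chains_uminus: "a \<in> simp_chains \<Delta> j \<Longrightarrow> - a \<in> simp_chains \<Delta> j"
  by (auto simp: simp_chains_def in_keys_iff)

lemma bdry_uminus: "bdry (- a) = - bdry a"
  using bdry_add[of a "- a"] by (simp add: eq_neg_iff_add_eq_0 add.commute)

lemma zero_in_simp_boundaries: "0 \<in> simp_boundaries \<Delta> j"
proof -
  have "0 \<in> simp_chains \<Delta> (j + 1)" by (simp add: simp_chains_def)
  then show ?thesis
    unfolding simp_boundaries_def by (intro image_eqI[of _ _ 0]) simp_all
qed

lemma simp_boundaries_add:
  "a \<in> simp_boundaries \<Delta> j \<Longrightarrow> b \<in> simp_boundaries \<Delta> j \<Longrightarrow> a + b \<in> simp_boundaries \<Delta> j"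
  by (auto simp: simp_boundaries_def simp_chains_add simp flip: bdry_add)

lemma simp_boundaries_uminus: "a \<in> simp_boundaries \<Delta> j \<Longrightarrow> - a \<in> simp_boundaries \<Delta> j"
  by (auto simp: simp_boundaries_def simp_chains_uminus simp flip: bdry_uminus)

lemma simp_boundaries_scale:
  "a \<in> simp_boundaries \<Delta> j \<Longrightarrow> Poly_Mapping.map ((*) k) a \<in> simp_boundaries \<Delta> j"
  by (auto simp: simp_boundaries_def simp_chains_scale simp flip: bdry_scale)

text \<open>
  When every cycle is a boundary, the only coset is the space of boundaries itself. The quotient
  is then the zero space, generated by the empty set. That it is a vector space has to be checked,
  because the dimension is characterised only for vector spaces.
\<close>
lemma dim_red_homology_eq_0:
  assumes cb: "(simp_cycles \<Delta> j :: 'k::field chain set) \<subseteq> simp_boundaries \<Delta> j"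
  shows "dim_red_homology TYPE('k) \<Delta> j = 0"
proof -
  let ?B = "simp_boundaries \<Delta> j :: 'k chain set"
  let ?V = "red_homology \<Delta> j :: ('k, 'k chain set) module"
  note B = zero_in_simp_boundaries[of \<Delta> j, where 'a='k] simp_boundaries_add simp_boundaries_uminus
    simp_boundaries_scale
  have coset: "{z + b | b. b \<in> ?B} = ?B" if "z \<in> ?B" for z
  proof (intro equalityI subsetI)
    fix y assume "y \<in> ?B"
    then have "- z + y \<in> ?B" using B that by blast
    moreover have "y = z + (- z + y)" by simp
    ultimately show "y \<in> {z + b | b. b \<in> ?B}" by blast
  qed (use B that in auto)
  have "0 \<in> (simp_cycles \<Delta> j :: 'k chain set)"
    by (simp add: simp_cycles_def simp_chains_def)
  then have carr: "carrier ?V = {?B}"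
    unfolding red_homology_def using coset cb by auto
  have add: "?B \<oplus>\<^bsub>?V\<^esub> ?B = ?B"
  proof -
    have "?B \<subseteq> {x + y | x y. x \<in> ?B \<and> y \<in> ?B}"
      using B(1) by force
    then show ?thesis using B(2) by (auto simp: red_homology_def)
  qed
  have smult: "k \<odot>\<^bsub>?V\<^esub> ?B = ?B" for k
  proof -
    have "Poly_Mapping.map ((*) k) 0 + b = b" for b :: "'k chain"
      by (rule poly_mapping_eqI) (simp add: lookup_add lookup_scale)
    then have "?B \<subseteq> {Poly_Mapping.map ((*) k) x + b | x b. x \<in> ?B \<and> b \<in> ?B}"
      using B(1) by force
    then show ?thesis by (auto simp: red_homology_def intro!: B(2,4))
  qed
  have zero: "\<zero>\<^bsub>?V\<^esub> = ?B" by (simp add: red_homology_def)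
  have K: "field (class_ring :: 'k ring)" by (rule class_field)
  have "abelian_group ?V"
    by (rule abelian_groupI) (simp_all add: carr add zero)
  then have "module class_ring ?V"
    using fieldE(1)[OF K] by (intro moduleI) (simp_all add: carr add smult)
  then interpret vectorspace class_ring ?V
    by (simp add: vectorspace_def K)
  have "span {} = carrier ?V"
    by (simp add: span_empty carr zero)
  then have "dim \<le> card ({} :: 'k chain set set)"
    by (intro gen_ge_dim) auto
  then show ?thesis by (simp add: dim_red_homology_def)
qed

text \<open>
  The hypothesis admits the void complex as well as the cones with apex \<open>v\<close>: a cone contains
  the face \<open>{v}\<close>, so \<open>{{}}\<close>, which has homology in degree \<open>-1\<close>, is excluded.
  A cycle \<open>z\<close> is the boundary of its cone, by the homotopy identity.
\<close>
lemma dim_red_homology_cone: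
  assumes fin: "\<And>F. F \<in> \<Delta> \<Longrightarrow> finite F"
    and cone: "\<And>F. F \<in> \<Delta> \<Longrightarrow> insert v F \<in> \<Delta>"
  shows "dim_red_homology TYPE('k::field) \<Delta> j = 0"
proof (rule dim_red_homology_eq_0, rule subsetI)
  fix z :: "'k chain" assume z: "z \<in> simp_cycles \<Delta> j"
  then have keys: "F \<in> \<Delta> \<and> int (card F) = j + 1" if "F \<in> Poly_Mapping.keys z" for F
    using that by (auto simp: simp_cycles_def simp_chains_def)
  have "bdry (cone_op v z) = z"
    using cone_homotopy[of z v] keys fin z by (simp add: simp_cycles_def)
  moreover have "cone_op v z \<in> simp_chains \<Delta> (j + 1)"
  proof -
    have "G \<in> \<Delta> \<and> int (card G) = j + 1 + 1" if "G \<in> Poly_Mapping.keys (cone_op v z)" for G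
    proof -
      have "G \<in> (\<Union>F\<in>Poly_Mapping.keys z. Poly_Mapping.keys (if v \<in> F then 0 else
          Poly_Mapping.single (insert v F) ((-1) ^ card {u \<in> F. u < v} * Poly_Mapping.lookup z F)))"
        using that unfolding cone_op_def by (rule subsetD[OF keys_sum_subset])
      then obtain F where F: "F \<in> Poly_Mapping.keys z" and "G \<in> Poly_Mapping.keys (if v \<in> F then 0 else
          Poly_Mapping.single (insert v F) ((-1) ^ card {u \<in> F. u < v} * Poly_Mapping.lookup z F))"
        by blast
      then have "v \<notin> F" "G = insert v F" by (auto split: if_splits)
      then show ?thesis using keys[OF F] fin cone by simp
    qed
    then show ?thesis by (auto simp: simp_chains_def)
  qed
  ultimately show "z \<in> simp_boundaries \<Delta> j"
    unfolding simp_boundaries_def by (metis image_eqI)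
qed

section \<open>The last entry of a stripped partition\<close>

lemma strict_sorted_vals: "sorted_wrt (>) (vals \<mu>)"
  using strict_sorted_list_of_set[of "set \<mu> - {0}"] unfolding vals_def sorted_wrt_rev by simp

lemma set_vals: "set (vals \<mu>) = set \<mu> - {0}"
  by (simp add: vals_def)

lemma val_in_set:
  assumes "1 \<le> i" "i \<le> blocks \<mu>"
  shows "val \<mu> i \<in> set \<mu>" and "val \<mu> i > 0"
proof -
  have "val \<mu> i \<in> set (vals \<mu>)"
    using assms unfolding val_def blocks_def by (intro nth_mem) linarith
  then show "val \<mu> i \<in> set \<mu>" and "val \<mu> i > 0"
    by (auto simp: set_vals)
qed

lemma val_less:
  assumes "1 \<le> i" "i < j" "j \<le> blocks \<mu>"
  shows "val \<mu> j < val \<mu> i"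
  using assms strict_sorted_vals[of \<mu>] sorted_wrt_nth_less[of "(>)" "vals \<mu>" "i - 1" "j - 1"]
  unfolding val_def blocks_def by linarith

lemma vals_cong: "set \<mu> - {0} = set \<nu> - {0} \<Longrightarrow> vals \<mu> = vals \<nu>"
  by (simp add: vals_def)

lemma strip_append_zero: "strip (\<nu> @ [0]) c = strip \<nu> c @ [0]"
proof -
  have "vals (\<nu> @ [0]) = vals \<nu>"
    by (rule vals_cong) auto
  then have blocks: "blocks (\<nu> @ [0]) = blocks \<nu>" and val: "val (\<nu> @ [0]) = val \<nu>"
    by (auto simp: blocks_def val_def fun_eq_iff)
  have "mult_val (\<nu> @ [0]) i = mult_val \<nu> i" if "1 \<le> i" "i \<le> blocks \<nu>" for i
    using val_in_set(2)[OF that] by (simp add: mult_val_def val)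
  then have "map (\<lambda>i. replicate (mult_val (\<nu> @ [0]) i - c i) (val \<nu> i) @ replicate (c i) (val \<nu> i - 1))
        [1..<Suc (blocks \<nu>)]
      = map (\<lambda>i. replicate (mult_val \<nu> i - c i) (val \<nu> i) @ replicate (c i) (val \<nu> i - 1))
        [1..<Suc (blocks \<nu>)]"
    by (intro map_cong) auto
  then have "strip (\<nu> @ [0]) c
      = concat (map (\<lambda>i. replicate (mult_val \<nu> i - c i) (val \<nu> i) @ replicate (c i) (val \<nu> i - 1))
          [1..<Suc (blocks \<nu>)]) @ replicate (count_list (\<nu> @ [0]) 0) 0"
    by (simp only: strip_def blocks val)
  then show ?thesis
    by (simp add: strip_def replicate_append_same del: upt_Suc)
qed

definition strip_init :: "nat list \<Rightarrow> (nat \<Rightarrow> nat) \<Rightarrow> nat list" where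
  "strip_init \<mu> c =
     concat (map (\<lambda>i. replicate (mult_val \<mu> i - c i) (val \<mu> i) @ replicate (c i) (val \<mu> i - 1))
                 [1..<blocks \<mu>])"

lemma strip_eq_init_append:
  assumes "blocks \<mu> \<ge> 1" "0 \<notin> set \<mu>"
  shows "strip \<mu> c = strip_init \<mu> c
     @ replicate (mult_val \<mu> (blocks \<mu>) - c (blocks \<mu>)) (val \<mu> (blocks \<mu>))
     @ replicate (c (blocks \<mu>)) (val \<mu> (blocks \<mu>) - 1)"
  using assms by (simp add: strip_def strip_init_def)

text \<open>
  Entries of earlier blocks are lowered by at most one from values strictly larger than
  \<open>d\<^sub>s\<close>.
\<close>
lemma strip_init_ge:
  assumes "x \<in> set (strip_init \<mu> c)"
  shows "val \<mu> (blocks \<mu>) \<le> x"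
proof -
  obtain i where i: "1 \<le> i" "i < blocks \<mu>" "x = val \<mu> i \<or> x = val \<mu> i - 1"
    using assms by (auto simp: strip_init_def)
  then show ?thesis
    using val_less[of i "blocks \<mu>" \<mu>] by auto
qed

lemma strip_init_cong:
  assumes "vals \<mu> = vals \<nu>"
    and "\<And>i. 1 \<le> i \<Longrightarrow> i < blocks \<mu> \<Longrightarrow> mult_val \<mu> i = mult_val \<nu> i \<and> c i = c' i"
  shows "strip_init \<mu> c = strip_init \<nu> c'"
proof -
  have "blocks \<mu> = blocks \<nu>" "val \<mu> = val \<nu>"
    using assms(1) by (auto simp: blocks_def val_def fun_eq_iff)
  then show ?thesis
    unfolding strip_init_def using assms(2) by (auto intro!: arg_cong[where f=concat])
qed

lemma last_block_positive:
  assumes \<mu>: "\<nu> @ [d] \<in> Parts m" and d: "d > 0"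
  shows "blocks (\<nu> @ [d]) \<ge> 1" and "0 \<notin> set (\<nu> @ [d])"
    and "val (\<nu> @ [d]) (blocks (\<nu> @ [d])) = d"
proof -
  let ?\<mu> = "\<nu> @ [d]"
  have ge: "d \<le> x" if "x \<in> set ?\<mu>" for x
    using \<mu> that by (auto simp: Parts_def sorted_wrt_append)
  then show "0 \<notin> set ?\<mu>" using d by force
  have "d \<in> set (vals ?\<mu>)" using d by (simp add: set_vals)
  then obtain k where k: "k < blocks ?\<mu>" "val ?\<mu> (Suc k) = d"
    by (auto simp: in_set_conv_nth blocks_def val_def)
  then show s: "blocks ?\<mu> \<ge> 1" by simp
  show "val ?\<mu> (blocks ?\<mu>) = d"
  proof (cases "Suc k = blocks ?\<mu>")
    case False
    then have "val ?\<mu> (blocks ?\<mu>) < d"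
      using val_less[of "Suc k" "blocks ?\<mu>" ?\<mu>] k by simp
    then show ?thesis using ge val_in_set(1)[OF s] by fastforce
  qed (use k in simp)
qed

lemma Delta_append_zero:
  assumes "L \<subseteq> Parts (length \<nu>)"
  shows "Delta (\<nu> @ [0]) c
           (sym_ideal (Suc (length \<nu>)) ((\<lambda>l. l @ [0]) ` L) :: 'k::field mpol set)
       = Delta \<nu> c (sym_ideal (length \<nu>) L :: 'k mpol set)"
proof -
  have "vals (\<nu> @ [0]) = vals \<nu>"
    by (rule vals_cong) auto
  then show ?thesis
    by (simp add: Delta_def blocks_def strip_append_zero append_in_Parts_of_ideal_iff[OF assms])
qed

text \<open>
  With \<open>c\<^sub>s = 0\<close>, the last block of \<open>\<mu> \ (\<^bold>c + \<^bold>e\<^sub>F)\<close> consists of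
  \<open>d\<^sub>s\<close> alone when \<open>s \<notin> F\<close>, and adding \<open>s\<close> to \<open>F\<close> changes only its final copy.
\<close>
lemma Delta_insert_last:
  assumes L: "L \<subseteq> Parts n" and \<mu>: "\<nu> @ [d] \<in> Parts (Suc n)" and d: "d > 0"
    and s: "s = blocks (\<nu> @ [d])" and cs: "c s = 0"
    and F: "F \<in> Delta (\<nu> @ [d]) c (sym_ideal (Suc n) ((\<lambda>l. l @ [0]) ` L) :: 'k::field mpol set)"
  shows "insert s F \<in> Delta (\<nu> @ [d]) c (sym_ideal (Suc n) ((\<lambda>l. l @ [0]) ` L) :: 'k mpol set)"
proof (cases "s \<in> F")
  case True
  then show ?thesis using F by (simp add: insert_absorb)
next
  case False
  let ?\<mu> = "\<nu> @ [d]" and ?I = "sym_ideal (Suc n) ((\<lambda>l. l @ [0]) ` L) :: 'k mpol set"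
  note last = last_block_positive[OF \<mu> d, folded s]
  have len: "length ?\<mu> = Suc n"
    using \<mu> by (simp add: Parts_def)
  obtain p where p: "mult_val ?\<mu> s = Suc p"
    using last(3) by (simp add: mult_val_def)
  define N where "N = strip_init ?\<mu> (\<lambda>i. c i + eF F i) @ replicate p d"
  have "strip_init ?\<mu> (\<lambda>i. c i + eF (insert s F) i) = strip_init ?\<mu> (\<lambda>i. c i + eF F i)"
    by (rule strip_init_cong) (auto simp: eF_def s)
  then have strip: "strip ?\<mu> (\<lambda>i. c i + eF F i) = N @ [d]"
      "strip ?\<mu> (\<lambda>i. c i + eF (insert s F) i) = N @ [d - 1]"
    using strip_eq_init_append[of ?\<mu>, folded s, OF last(1,2)] False cs p
    by (simp_all add: last(3) N_def eF_def replicate_append_same)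
  have "N @ [d] \<in> Parts_of_ideal (Suc n) ?I" "F \<subseteq> {1..s}"
    using F unfolding Delta_def s[symmetric] len by (simp_all add: strip)
  moreover have "\<forall>y\<in>set N. d - 1 \<le> y"
    using strip_init_ge[of _ ?\<mu>, folded s] last(3) by (fastforce simp: N_def)
  ultimately show ?thesis
    using last(1) unfolding Delta_def s[symmetric] len
    by (simp add: strip append_in_Parts_of_ideal_iff[OF L])
qed

text \<open>
  The bound \<open>\<^bold>c \<le> \<^bold>p(\<mu>)\<close> and \<open>c\<^sub>s > 0\<close> force \<open>p\<^sub>s \<ge> 2\<close>. So
  deleting the last entry leaves a copy of \<open>d\<^sub>s\<close>: the values of \<open>\<nu>\<close> are those of
  \<open>\<mu>\<close>, and \<open>p\<^sub>s\<close> and \<open>c\<^sub>s\<close> both drop by one, which keeps the number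
  \<open>p\<^sub>s - c\<^sub>s\<close> of untouched copies.
\<close>
lemma Delta_drop_last:
  assumes L: "L \<subseteq> Parts n" and \<mu>: "\<nu> @ [d] \<in> Parts (Suc n)" and d: "d > 0"
    and s: "s = blocks (\<nu> @ [d])" and cs: "c s > 0" and c: "below_p (\<nu> @ [d]) c"
  shows "Delta (\<nu> @ [d]) c (sym_ideal (Suc n) ((\<lambda>l. l @ [0]) ` L) :: 'k::field mpol set)
       = Delta \<nu> (\<lambda>j. c j - eF {s} j) (sym_ideal n L :: 'k mpol set)"
proof -
  let ?\<mu> = "\<nu> @ [d]"
  note last = last_block_positive[OF \<mu> d, folded s]
  have len: "length \<nu> = n"
    using \<mu> by (simp add: Parts_def)
  have "c s \<le> mult_val ?\<mu> s - 1"
    using c last(1) by (simp add: below_p_def flip: s)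
  then have cs_le: "c s \<le> count_list \<nu> d"
    by (simp add: mult_val_def last(3))
  with cs have "d \<in> set \<nu>"
    by (metis count_list_0_iff leD)
  then have vals: "vals ?\<mu> = vals \<nu>"
    by (intro vals_cong) auto
  then have val: "val ?\<mu> = val \<nu>" and blocks: "blocks \<nu> = s"
    by (auto simp: val_def fun_eq_iff s blocks_def)
  have d_val: "val \<nu> s = d"
    using last(3) val by simp
  have mult_s: "mult_val \<nu> s = count_list \<nu> d" "mult_val ?\<mu> s = Suc (count_list \<nu> d)"
    by (simp_all add: mult_val_def val d_val)
  have mult: "mult_val ?\<mu> i = mult_val \<nu> i" if "1 \<le> i" "i < s" for i
    using val_less[of i s \<nu>] that by (simp add: mult_val_def val d_val blocks)
  have "strip ?\<mu> (\<lambda>i. c i + eF F i) = strip \<nu> (\<lambda>i. c i - eF {s} i + eF F i) @ [d - 1]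
      \<and> (\<forall>y\<in>set (strip \<nu> (\<lambda>i. c i - eF {s} i + eF F i)). d - 1 \<le> y)" for F
  proof -
    have "strip_init ?\<mu> (\<lambda>i. c i + eF F i) = strip_init \<nu> (\<lambda>i. c i - eF {s} i + eF F i)"
      by (rule strip_init_cong) (auto simp: vals mult eF_def simp flip: s)
    then have "strip ?\<mu> (\<lambda>i. c i + eF F i) = strip_init \<nu> (\<lambda>i. c i - eF {s} i + eF F i)
        @ replicate (count_list \<nu> d - (c s - 1 + eF F s)) d @ replicate (c s + eF F s) (d - 1)"
      using strip_eq_init_append[of ?\<mu> "\<lambda>i. c i + eF F i", folded s, OF last(1,2)] cs
      by (simp add: mult_s val d_val)
    moreover have "strip \<nu> (\<lambda>i. c i - eF {s} i + eF F i) = strip_init \<nu> (\<lambda>i. c i - eF {s} i + eF F i)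
        @ replicate (count_list \<nu> d - (c s - 1 + eF F s)) d @ replicate (c s - 1 + eF F s) (d - 1)"
      using strip_eq_init_append[of \<nu> "\<lambda>i. c i - eF {s} i + eF F i", unfolded blocks] last(1,2)
      by (simp add: mult_s d_val eF_def)
    moreover have "replicate (c s + eF F s) (d - 1) = replicate (c s - 1 + eF F s) (d - 1) @ [d - 1]"
      using cs by (cases "c s") (simp_all add: replicate_append_same)
    ultimately show ?thesis
      using strip_init_ge[of _ \<nu>, unfolded blocks d_val] by fastforce
  qed
  then show ?thesis
    unfolding Delta_def blocks s[symmetric] len
    by (simp add: len append_in_Parts_of_ideal_iff[OF L])
qed

theorem theorem6p2:
  fixes n r :: nat
    and lam :: "nat \<Rightarrow> nat list"
    and I I' :: "'k::field mpol set"
    and \<mu> :: "nat list"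
    and c :: "nat \<Rightarrow> nat"
    and s i :: nat
  assumes lam: "\<And>k. k \<in> {1..r} \<Longrightarrow> lam k \<in> Parts n"
    and I: "I = sym_ideal n (lam ` {1..r})"
    and I': "I' = sym_ideal (n + 1) ((\<lambda>k. lam k @ [0]) ` {1..r})"
    and mu: "\<mu> \<in> Parts (n + 1)"
    and s: "s = blocks \<mu>"
    and c: "below_p \<mu> c"
    and i: "0 \<le> i" "i \<le> n"
  shows "(\<mu> ! n = 0 \<longrightarrow> gam \<mu> c i I' = gam (take n \<mu>) c i I) \<and>
         (\<mu> ! n > 0 \<longrightarrow>
            gam \<mu> c i I' =
              (if c s = 0 then 0 else gam (take n \<mu>) (\<lambda>j. c j - eF {s} j) i I))"
proof -
  define L where "L = lam ` {1..r}"
  define \<nu> where "\<nu> = take n \<mu>"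
  have L: "L \<subseteq> Parts n"
    using lam by (auto simp: L_def)
  have "I' = sym_ideal (Suc n) ((\<lambda>l. l @ [0]) ` L)"
    by (simp add: I' L_def image_image)
  note II' = I[folded L_def] this
  have len: "length \<mu> = Suc n"
    using mu by (simp add: Parts_def)
  then have \<mu>: "\<mu> = \<nu> @ [\<mu> ! n]" and len_\<nu>: "length \<nu> = n"
    by (simp_all add: \<nu>_def flip: take_Suc_conv_app_nth)
  have mu': "\<nu> @ [\<mu> ! n] \<in> Parts (Suc n)" and s': "s = blocks (\<nu> @ [\<mu> ! n])"
    and c': "below_p (\<nu> @ [\<mu> ! n]) c"
    using mu s c \<mu> by simp_all
  have "Delta \<mu> c I' = Delta \<nu> c I" if "\<mu> ! n = 0"
    using Delta_append_zero[of L \<nu> c, where 'k='k] L len_\<nu> II' \<mu> that by simp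
  moreover have "gam \<mu> c i I' = 0" if d: "\<mu> ! n > 0" and "c s = 0"
    unfolding gam_def
  proof (rule dim_red_homology_cone[of _ s])
    show "finite F" if "F \<in> Delta \<mu> c I'" for F
      using that finite_subset by (auto simp: Delta_def)
    show "insert s F \<in> Delta \<mu> c I'" if "F \<in> Delta \<mu> c I'" for F
      using Delta_insert_last[where 'k='k and c=c and F=F, OF L mu' d s' \<open>c s = 0\<close>] II'(2) that \<mu> by simp
  qed
  moreover have "Delta \<mu> c I' = Delta \<nu> (\<lambda>j. c j - eF {s} j) I" if d: "\<mu> ! n > 0" and "c s > 0"
    using Delta_drop_last[where 'k='k and c=c, OF L mu' d s' \<open>c s > 0\<close> c'] II' \<mu> by simp
  ultimately show ?thesis
    by (auto simp: gam_def \<nu>_def)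
qed

end
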